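(* Suppose $\Phi'\subseteq\Phi\subseteq BC_n$ are nested root systems. Then: (a) if $\Phi=A_{n-1}$, $\Phi'$ is equivalent to a direct sum of type-$A$ irreducible root systems; (b) if $\Phi=D_n$, $\Phi'$ is equivalent to a direct sum of type-$A$ and type-$D$ irreducible root systems; (c) if $\Phi=B_n$, $\Phi'$ is equivalent to a direct sum of type-$A$, type-$D$ and type-$B$ irreducible root systems; (d) if $\Phi=C_n$, $\Phi'$ is equivalent to a direct sum of type-$A$, type-$D$ and type-$C$ irreducible root systems.
   Context: Let $n\geq1$ and $V=\mathbb{C}^n$ with canonical basis $(e_1,\dots,e_n)$ and scalar product $(e_i\mid e_j)=\delta_{ij}$. For a nonempty $I\subseteq\{1,\dots,n\}$ set $A_I=\{e_i-e_j : i\neq j\in I\}$, $D_I=A_I\cup\{\pm(e_i+e_j): i\ne j\in I\}$, $B_I=D_I\cup\{\pm e_i: i\in I\}$, $C_I=D_I\cup\{\pm 2e_i : i\in I\}$, $BC_I=B_I\cup C_I$. For $I=\{1,\dots,n\}$ these are denoted $A_{n-1},D_n,B_n,C_n,BC_n$. The members of these families are referred to as the classical irreducible root systems of type $A$, $D$, $B$, $C$, $BC$ respectively (with $A_I=\varnothing$ when $|I|=1$). A root subsystem of a root system $\Psi\subseteq V$ is a subset $\Phi\subseteq\Psi$ with $\sigma_\alpha(\Phi)\subseteq\Phi$ for all $\alpha\in\Phi$, where $\sigma_\alpha$ is the orthogonal reflection defined by $\alpha$; "nested root systems $\Phi'\subseteq\Phi\subseteq BC_n$" means that both are root subsystems of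 $BC_n$. Two root subsystems of $BC_n$ are equivalent if they lie in the same orbit of the Weyl group $W(BC_n)$. A direct sum of irreducible root systems of given types, inside $BC_n$, is a union of such systems supported on pairwise disjoint subsets $I_k\subseteq\{1,\dots,n\}$ of coordinates. *)

theory Defs
  imports "HOL-Analysis.Analysis" "HOL-Algebra.Bij" "HOL-Algebra.Generated_Groups"
begin

text \<open>The space \<open>V\<close> is \<open>complex ^ 'n\<close>; the finite (nonempty) index type \<open>'n\<close> plays the role of
  \<open>{1, ..., n}\<close>, so \<open>n \<ge> 1\<close> is automatic.\<close>

abbreviation basis_vec :: "'n::finite \<Rightarrow> complex ^ 'n" where
  "basis_vec i \<equiv> axis i 1"

definition scalar_prod :: "complex ^ 'n::finite \<Rightarrow> complex ^ 'n \<Rightarrow> complex" where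
  "scalar_prod x y = (\<Sum>i\<in>UNIV. x $ i * cnj (y $ i))"

definition reflection :: "complex ^ 'n::finite \<Rightarrow> complex ^ 'n \<Rightarrow> complex ^ 'n" where
  "reflection \<alpha> v = v - (2 * scalar_prod v \<alpha> / scalar_prod \<alpha> \<alpha>) *s \<alpha>"

definition roots_A :: "'n::finite set \<Rightarrow> (complex ^ 'n) set" where
  "roots_A I = {basis_vec i - basis_vec j | i j. i \<in> I \<and> j \<in> I \<and> i \<noteq> j}"

definition roots_D :: "'n::finite set \<Rightarrow> (complex ^ 'n) set" where
  "roots_D I = roots_A I
     \<union> {basis_vec i + basis_vec j | i j. i \<in> I \<and> j \<in> I \<and> i \<noteq> j}
     \<union> {- (basis_vec i + basis_vec j) | i j. i \<in> I \<and> j \<in> I \<and> i \<noteq> j}"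

definition roots_B :: "'n::finite set \<Rightarrow> (complex ^ 'n) set" where
  "roots_B I = roots_D I \<union> {basis_vec i | i. i \<in> I} \<union> {- basis_vec i | i. i \<in> I}"

definition roots_C :: "'n::finite set \<Rightarrow> (complex ^ 'n) set" where
  "roots_C I = roots_D I \<union> {2 *s basis_vec i | i. i \<in> I} \<union> {- (2 *s basis_vec i) | i. i \<in> I}"

definition roots_BC :: "'n::finite set \<Rightarrow> (complex ^ 'n) set" where
  "roots_BC I = roots_B I \<union> roots_C I"

definition root_subsystem :: "(complex ^ 'n::finite) set \<Rightarrow> (complex ^ 'n) set \<Rightarrow> bool" where
  "root_subsystem \<Psi> \<Phi> \<longleftrightarrow> \<Phi> \<subseteq> \<Psi> \<and> (\<forall>\<alpha>\<in>\<Phi>. reflection \<alpha> ` \<Phi> \<subseteq> \<Phi>)"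

definition weyl_group :: "(complex ^ 'n::finite) set \<Rightarrow> (complex ^ 'n \<Rightarrow> complex ^ 'n) set" where
  "weyl_group \<Psi> = generate (BijGroup UNIV) (reflection ` \<Psi>)"

definition equivalent_subsystems :: "(complex ^ 'n::finite) set \<Rightarrow> (complex ^ 'n) set \<Rightarrow> bool" where
  "equivalent_subsystems \<Phi> \<Phi>' \<longleftrightarrow>
     root_subsystem (roots_BC UNIV) \<Phi> \<and> root_subsystem (roots_BC UNIV) \<Phi>' \<and>
     (\<exists>w\<in>weyl_group (roots_BC UNIV). \<Phi>' = w ` \<Phi>)"

datatype classical_type = Type_A | Type_D | Type_B | Type_C | Type_BC

fun classical_roots :: "classical_type \<Rightarrow> 'n::finite set \<Rightarrow> (complex ^ 'n) set" where
  "classical_roots Type_A = roots_A"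
| "classical_roots Type_D = roots_D"
| "classical_roots Type_B = roots_B"
| "classical_roots Type_C = roots_C"
| "classical_roots Type_BC = roots_BC"

text \<open>The supports are nonempty and pairwise disjoint, hence distinct, so the summands can be
  indexed by the supports themselves; \<open>t I\<close> is the type of the summand supported on \<open>I\<close>. Every
  nonempty support is allowed for every type, including \<open>roots_A {i} = {}\<close>, \<open>roots_D {i} = {}\<close>,
  and \<open>roots_D {i, j}\<close>, which is not irreducible in the usual sense.\<close>

definition direct_sum_of_types :: "classical_type set \<Rightarrow> (complex ^ 'n::finite) set \<Rightarrow> bool" where
  "direct_sum_of_types T \<Psi> \<longleftrightarrow>
     (\<exists>\<I> t. disjoint \<I> \<and> {} \<notin> \<I> \<and> t ` \<I> \<subseteq> T \<and> \<Psi> = (\<Union>I\<in>\<I>. classical_roots (t I) I))"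

end

theory Submission imports Defs
begin

text \<open>A root subsystem \<open>\<Phi>\<close> of \<open>BC\<^sub>n\<close> is a graph on the coordinates: \<open>i \<noteq> j\<close> are joined when some
  root \<open>\<plusminus>e\<^sub>i \<plusminus> e\<^sub>j\<close> lies in \<open>\<Phi>\<close>, and \<open>i\<close> carries a mark when \<open>\<plusminus>e\<^sub>i\<close> or \<open>\<plusminus>2e\<^sub>i\<close> does. Reflecting one edge
  in an adjacent one makes ``joined'' transitive, so the components are complete graphs, and they
  are the supports of the summands.

  Changing the signs of some coordinates is a product of reflections in the \<open>e\<^sub>i\<close>, hence an element
  of \<open>W(BC\<^sub>n)\<close>. A suitable sign change makes \<open>\<Phi>\<close> balanced: whenever two indices are joined, they are
  joined by \<open>e\<^sub>i - e\<^sub>j\<close> (\<open>ex_balanced_flip\<close>). In a balanced system the reflections in the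
  \<open>e\<^sub>i - e\<^sub>j\<close> act on each component \<open>I\<close> as the full symmetric group. Hence the short roots, the long
  roots and the edges \<open>e\<^sub>i + e\<^sub>j\<close> are each present everywhere in \<open>I\<close> or nowhere, and a short or long
  root forces the edges \<open>e\<^sub>i + e\<^sub>j\<close>. This leaves exactly the types \<open>A\<close>, \<open>D\<close>, \<open>B\<close>, \<open>C\<close> and \<open>BC\<close> on
  \<open>I\<close> (\<open>balanced_direct_sum\<close>).

  Which of the five types occurs depends only on whether there is a short root, a long root, or a
  doubly joined pair of indices. Sign changes do not affect this (\<open>block_type_flip\<close>), so the types can
  be read off from \<open>\<Phi>\<close> itself. An ambient system \<open>A\<^sub>n\<^sub>-\<^sub>1\<close>, \<open>D\<^sub>n\<close>, \<open>B\<^sub>n\<close> or \<open>C\<^sub>n\<close> lacks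
  the roots that the excluded types require, which gives the four cases.\<close>

section \<open>Roots as signed combinations of basis vectors\<close>

lemma axis_apply: "axis i c $ j = (if j = i then c else 0)"
  by (simp add: axis_def)

lemma roots_A_eq: "roots_A I = {axis i 1 + axis j (-1) | i j. i \<in> I \<and> j \<in> I \<and> i \<noteq> j}"
proof -
  have "basis_vec i - basis_vec j = (axis i 1 + axis j (-1) :: complex ^ 'a)" for i j :: 'a
    by (simp add: vec_eq_iff axis_apply)
  then show ?thesis
    by (simp only: roots_A_def)
qed

lemma roots_D_eq:
  "roots_D I = {axis i s + axis j t | i j s t.
     i \<in> I \<and> j \<in> I \<and> i \<noteq> j \<and> s \<in> {1, -1} \<and> t \<in> {1, -1}}" (is "_ = ?R")
proof -
  have plus: "- (basis_vec i + basis_vec j) = (axis i (-1) + axis j (-1) :: complex ^ 'a)" for i j :: 'a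
    by (simp add: vec_eq_iff axis_apply)
  show ?thesis
  proof
    show "roots_D I \<subseteq> ?R"
      unfolding roots_D_def roots_A_eq plus by blast
    show "?R \<subseteq> roots_D I"
    proof
      fix x assume "x \<in> ?R"
      then obtain i j s t where x: "x = axis i s + axis j t"
        and ij: "i \<in> I" "j \<in> I" "i \<noteq> j" and st: "s \<in> {1, -1}" "t \<in> {1, -1}" by blast
      from st consider "s = 1" "t = 1" | "s = 1" "t = -1" | "s = -1" "t = 1" | "s = -1" "t = -1"
        by blast
      then show "x \<in> roots_D I"
      proof cases
        case 3
        then have "x = axis j 1 + axis i (-1)" by (simp add: x add.commute)
        then show ?thesis using ij unfolding roots_D_def roots_A_eq by blast
      qed (use ij x in \<open>unfold roots_D_def roots_A_eq plus, blast+\<close>)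
    qed
  qed
qed

lemma roots_B_eq: "roots_B I = roots_D I \<union> {axis i s | i s. i \<in> I \<and> s \<in> {1, -1}}"
proof -
  have "- basis_vec i = (axis i (-1) :: complex ^ 'a)" for i :: 'a
    by (simp add: vec_eq_iff axis_apply)
  then show ?thesis
    unfolding roots_B_def by auto
qed

lemma roots_C_eq: "roots_C I = roots_D I \<union> {axis i s | i s. i \<in> I \<and> s \<in> {2, -2}}"
proof -
  have "- (2 *s basis_vec i) = (axis i (-2) :: complex ^ 'a)"
    "2 *s basis_vec i = (axis i 2 :: complex ^ 'a)" for i :: 'a
    by (simp_all add: vec_eq_iff axis_apply)
  then show ?thesis
    unfolding roots_C_def by auto
qed

lemma roots_BC_cases:
  assumes "x \<in> roots_BC I"
  obtains (pair) i j s t where "x = axis i s + axis j t" "i \<in> I" "j \<in> I" "i \<noteq> j"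
      "s \<in> {1, -1}" "t \<in> {1, -1}"
    | (single) i c where "x = axis i c" "i \<in> I" "c \<in> {1, -1, 2, -2}"
  using assms unfolding roots_BC_def roots_B_eq roots_C_eq roots_D_eq by blast

lemma pair_in_roots_BC:
  "\<lbrakk>i \<in> I; j \<in> I; i \<noteq> j; s \<in> {1, -1}; t \<in> {1, -1}\<rbrakk> \<Longrightarrow> axis i s + axis j t \<in> roots_BC I"
  unfolding roots_BC_def roots_B_eq roots_D_eq by blast

lemma single_in_roots_BC: "\<lbrakk>i \<in> I; c \<in> {1, -1, 2, -2}\<rbrakk> \<Longrightarrow> axis i c \<in> roots_BC I"
  unfolding roots_BC_def roots_B_eq roots_C_eq by blast

text \<open>The following four facts say which kinds of root an ambient system of type \<open>D\<close>, \<open>B\<close>, \<open>C\<close> or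
  \<open>A\<close> excludes; they decide which types of summand can occur.\<close>

lemma axis_notin_roots_D: "axis i c \<notin> roots_D I"
proof
  assume "axis i c \<in> roots_D I"
  then obtain k l s t where kl: "k \<noteq> l" and st: "s \<in> {1, -1}" "t \<in> {1, -1}"
    and eq: "axis i c = (axis k s + axis l t :: complex ^ 'a)"
    unfolding roots_D_eq by blast
  have "(axis i c :: complex ^ 'a) $ k \<noteq> 0" "(axis i c :: complex ^ 'a) $ l \<noteq> 0"
    unfolding eq using kl st by (auto simp: axis_apply)
  then show False
    using kl by (simp add: axis_apply split: if_splits)
qed

lemma long_notin_roots_B: "axis i 2 \<notin> roots_B I"
proof
  assume "axis i 2 \<in> roots_B I"
  then obtain j s where "axis i 2 = (axis j s :: complex ^ 'a)" "s \<in> {1, -1}"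
    unfolding roots_B_eq using axis_notin_roots_D by blast
  then show False
    by (auto simp: axis_eq_axis)
qed

lemma short_notin_roots_C: "axis i 1 \<notin> roots_C I"
proof
  assume "axis i 1 \<in> roots_C I"
  then obtain j s where "axis i 1 = (axis j s :: complex ^ 'a)" "s \<in> {2, -2}"
    unfolding roots_C_eq using axis_notin_roots_D by blast
  then show False
    by (auto simp: axis_eq_axis)
qed

lemma plus_notin_roots_A:
  assumes "i \<noteq> j"
  shows "axis i 1 + axis j 1 \<notin> roots_A I"
proof
  assume "axis i 1 + axis j 1 \<in> roots_A I"
  then obtain k l where "k \<noteq> l" "axis i 1 + axis j 1 = (axis k 1 + axis l (-1) :: complex ^ 'a)"
    unfolding roots_A_eq by blast
  then have "(axis i 1 + axis j 1 :: complex ^ 'a) $ l = -1"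
    by (simp add: axis_apply)
  then show False
    using assms by (auto simp: axis_apply split: if_splits)
qed

section \<open>Reflections in roots\<close>

lemma scalar_prod_axis: "scalar_prod v (axis i s) = v $ i * cnj s"
proof -
  have "scalar_prod v (axis i s) = (\<Sum>k\<in>UNIV. if k = i then v $ i * cnj s else 0)"
    unfolding scalar_prod_def by (rule sum.cong) (auto simp: axis_apply)
  then show ?thesis by simp
qed

lemma scalar_prod_add_right: "scalar_prod v (a + b) = scalar_prod v a + scalar_prod v b"
  by (simp add: scalar_prod_def algebra_simps sum.distrib)

definition flip :: "'n::finite set \<Rightarrow> complex ^ 'n \<Rightarrow> complex ^ 'n" where
  "flip S v = (\<chi> i. if i \<in> S then - v $ i else v $ i)"

lemma reflection_single:
  assumes "c \<in> {1, -1, 2, -2}"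
  shows "reflection (axis i c) = flip {i}"
  using assms by (auto simp: fun_eq_iff reflection_def flip_def scalar_prod_axis vec_eq_iff axis_apply)

text \<open>The reflection in \<open>s e\<^sub>i + t e\<^sub>j\<close> swaps the coordinates \<open>i\<close> and \<open>j\<close> and multiplies both by
  \<open>- s t\<close>: a plain swap for \<open>e\<^sub>i - e\<^sub>j\<close>, a swap with two sign changes for \<open>e\<^sub>i + e\<^sub>j\<close>.\<close>

lemma reflection_pair:
  assumes "i \<noteq> j" "s \<in> {1, -1}" "t \<in> {1, -1}"
  shows "reflection (axis i s + axis j t) v =
    (\<chi> k. if k = i then - (s * t * v $ j) else if k = j then - (s * t * v $ i) else v $ k)"
  using assms
  by (auto simp: reflection_def scalar_prod_axis scalar_prod_add_right vec_eq_iff axis_apply field_simps)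

lemma reflection_pair_single:
  assumes "i \<noteq> j" "s \<in> {1, -1}" "t \<in> {1, -1}"
  shows "reflection (axis i s + axis j t) (axis i u) = axis j (- (s * t * u))"
  unfolding reflection_pair[OF assms] using assms by (auto simp: vec_eq_iff axis_apply)

lemma reflection_pair_pair:
  assumes "i \<noteq> j" "k \<noteq> i" "k \<noteq> j" "s \<in> {1, -1}" "t \<in> {1, -1}"
  shows "reflection (axis i s + axis j t) (axis i u + axis k w) = axis j (- (s * t * u)) + axis k w"
  unfolding reflection_pair[OF assms(1,4,5)] using assms by (auto simp: vec_eq_iff axis_apply)

lemma reflection_self:
  assumes "\<alpha> \<in> roots_BC I"
  shows "reflection \<alpha> \<alpha> = - \<alpha>"
  using assms
proof (cases rule: roots_BC_cases)
  case (pair i j s t)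
  then show ?thesis
    unfolding pair(1) reflection_pair[OF pair(4,5,6)] by (auto simp: vec_eq_iff axis_apply)
next
  case (single i c)
  then show ?thesis
    unfolding single(1) reflection_single[OF single(3)] by (auto simp: flip_def vec_eq_iff axis_apply)
qed

section \<open>Sign changes belong to the Weyl group\<close>

lemma flip_axis: "flip S (axis i c) = axis i (if i \<in> S then - c else c)"
  by (auto simp: flip_def vec_eq_iff axis_apply)

lemma flip_add: "flip S (x + y) = flip S x + flip S y"
  by (simp add: flip_def vec_eq_iff)

lemma flip_flip [simp]: "flip S (flip S x) = x"
  by (simp add: flip_def vec_eq_iff)

lemma mem_flip_image_iff: "x \<in> flip S ` \<Phi> \<longleftrightarrow> flip S x \<in> \<Phi>"
  by (metis flip_flip image_iff)

lemma flip_reflection: "flip S (reflection \<alpha> x) = reflection (flip S \<alpha>) (flip S x)"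
proof -
  have "scalar_prod (flip S x) (flip S y) = scalar_prod x y" for x y
    unfolding scalar_prod_def by (rule sum.cong) (auto simp: flip_def)
  then show ?thesis
    by (simp add: reflection_def) (simp add: flip_def vec_eq_iff)
qed

lemma flip_in_weyl_group: "flip S \<in> weyl_group (roots_BC UNIV)"
proof (induction S rule: finite_induct[OF finite])
  case 1
  have "flip {} = \<one>\<^bsub>BijGroup UNIV\<^esub>"
    by (auto simp: flip_def BijGroup_def fun_eq_iff)
  then show ?case
    unfolding weyl_group_def by (metis generate.one)
next
  case (2 i S)
  have bij: "flip T \<in> Bij UNIV" for T :: "'a set"
    unfolding Bij_def by (auto intro: o_bij[of "flip T" "flip T"] simp: fun_eq_iff extensional_def)
  have "flip {i} \<in> reflection ` roots_BC UNIV"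
    using reflection_single[of 1 i] single_in_roots_BC[of i UNIV 1] by (metis UNIV_I image_eqI insertI1)
  then have "flip {i} \<otimes>\<^bsub>BijGroup UNIV\<^esub> flip S \<in> weyl_group (roots_BC UNIV)"
    using 2 unfolding weyl_group_def by (blast intro: generate.intros)
  moreover have "flip {i} \<otimes>\<^bsub>BijGroup UNIV\<^esub> flip S = flip (insert i S)"
    using 2(2) bij
    by (auto simp: BijGroup_def compose_def fun_eq_iff flip_def vec_eq_iff)
  ultimately show ?case by simp
qed

lemma flip_in_roots_BC:
  assumes "x \<in> roots_BC I"
  shows "flip S x \<in> roots_BC I"
  using assms
proof (cases rule: roots_BC_cases)
  case (pair i j s t)
  then show ?thesis
    by (simp only: flip_add flip_axis) (rule pair_in_roots_BC; auto)
next
  case (single i c)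
  then show ?thesis
    by (simp only: flip_axis) (rule single_in_roots_BC; auto)
qed

lemma root_subsystem_flip:
  assumes "root_subsystem (roots_BC UNIV) \<Phi>"
  shows "root_subsystem (roots_BC UNIV) (flip S ` \<Phi>)"
  using assms flip_in_roots_BC
  unfolding root_subsystem_def image_subset_iff by (force simp flip: flip_reflection)

section \<open>Root subsystems as signed graphs\<close>

text \<open>For a root subsystem of \<open>BC\<^sub>n\<close> this says that \<open>e\<^sub>i - e\<^sub>j\<close> is a root whenever \<open>i \<noteq> j\<close> are joined
  by any root.\<close>

definition balanced :: "(complex ^ 'n::finite) set \<Rightarrow> bool" where
  "balanced \<Phi> \<longleftrightarrow>
    (\<forall>i j. i \<noteq> j \<longrightarrow> axis i 1 + axis j 1 \<in> \<Phi> \<longrightarrow> axis i 1 + axis j (-1) \<in> \<Phi>)"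

definition block_type :: "(complex ^ 'n::finite) set \<Rightarrow> 'n set \<Rightarrow> classical_type" where
  "block_type \<Phi> I =
    (if \<exists>i\<in>I. axis i 1 \<in> \<Phi> then if \<exists>i\<in>I. axis i 2 \<in> \<Phi> then Type_BC else Type_B
     else if \<exists>i\<in>I. axis i 2 \<in> \<Phi> then Type_C
     else if \<exists>i\<in>I. \<exists>j\<in>I. i \<noteq> j \<and> axis i 1 + axis j 1 \<in> \<Phi> \<and> axis i 1 + axis j (-1) \<in> \<Phi> then Type_D
     else Type_A)"

context
  fixes \<Phi> :: "(complex ^ 'n::finite) set"
  assumes subsystem: "root_subsystem (roots_BC UNIV) \<Phi>"
begin

lemma reflection_closed: "\<alpha> \<in> \<Phi> \<Longrightarrow> x \<in> \<Phi> \<Longrightarrow> reflection \<alpha> x \<in> \<Phi>"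
  using subsystem unfolding root_subsystem_def by blast

lemma uminus_closed: "x \<in> \<Phi> \<Longrightarrow> - x \<in> \<Phi>"
  using reflection_closed[of x x] reflection_self[of x UNIV] subsystem
  unfolding root_subsystem_def by auto

lemma single_neg: "axis i (- c) \<in> \<Phi> \<longleftrightarrow> axis i c \<in> \<Phi>"
proof -
  have "- axis i c = (axis i (- c) :: complex ^ 'n)" for c
    by (simp add: vec_eq_iff axis_apply)
  then show ?thesis
    by (metis uminus_closed minus_minus)
qed

text \<open>Up to an overall sign, only the product of the two signs of an edge matters.\<close>

lemma pair_iff:
  assumes "s \<in> {1, -1}" "t \<in> {1, -1}"
  shows "axis i s + axis j t \<in> \<Phi> \<longleftrightarrow> axis i 1 + axis j (s * t) \<in> \<Phi>"
proof -
  have "- (axis i c + axis j d) = (axis i (- c) + axis j (- d) :: complex ^ 'n)" for c d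
    by (simp add: vec_eq_iff axis_apply)
  then have "axis i (- c) + axis j (- d) \<in> \<Phi> \<longleftrightarrow> axis i c + axis j d \<in> \<Phi>" for c d
    by (metis uminus_closed minus_minus)
  from this[of 1 t] this[of 1 "- t"] show ?thesis
    using assms by auto
qed

lemma pair_commute:
  assumes "s \<in> {1, -1}"
  shows "axis i 1 + axis j s \<in> \<Phi> \<longleftrightarrow> axis j 1 + axis i s \<in> \<Phi>"
  using pair_iff[of s 1 j i] assms by (simp add: add.commute)

text \<open>Reflecting the edge \<open>j k\<close> in the edge \<open>i j\<close> gives the edge \<open>i k\<close>. Writing an edge as
  \<open>e\<^sub>i - c e\<^sub>j\<close>, its sign \<open>c\<close> is multiplicative along paths.\<close>

lemma pair_compose:
  assumes "axis i 1 + axis j s \<in> \<Phi>" "axis j 1 + axis k t \<in> \<Phi>"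
    and "i \<noteq> j" "j \<noteq> k" "i \<noteq> k" and "s \<in> {1, -1}" "t \<in> {1, -1}"
  shows "axis i 1 + axis k (- (s * t)) \<in> \<Phi>"
proof -
  have "axis j 1 + axis i s \<in> \<Phi>"
    using assms pair_commute by blast
  then have "axis i (- s) + axis k t \<in> \<Phi>"
    using reflection_closed[OF _ assms(2)] reflection_pair_pair[of j i k 1 s 1 t] assms by fastforce
  then show ?thesis
    using pair_iff[of "- s" t i k] assms by auto
qed

lemma single_transport:
  assumes "axis i c \<in> \<Phi>" "axis i 1 + axis j (-1) \<in> \<Phi>" "i \<noteq> j"
  shows "axis j c \<in> \<Phi>"
  using reflection_closed[OF assms(2,1)] reflection_pair_single[of i j 1 "-1" c] assms(3) by simp

lemma plus_of_minus_single:
  assumes "axis i c \<in> \<Phi>" "c \<in> {1, -1, 2, -2}" "axis i 1 + axis j (-1) \<in> \<Phi>" "i \<noteq> j"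
  shows "axis i 1 + axis j 1 \<in> \<Phi>"
proof -
  have "reflection (axis i c) (axis i 1 + axis j (-1)) = axis i (-1) + axis j (-1)"
    using assms(2,4) by (simp only: reflection_single flip_add flip_axis) simp
  then show ?thesis
    using reflection_closed[OF assms(1,3)] pair_iff[of "-1" "-1" i j] by simp
qed

text \<open>In each component choose a base index \<open>r\<close> and change the sign of those \<open>i\<close> that are joined to
  \<open>r\<close> only by \<open>e\<^sub>r + e\<^sub>i\<close>. Since components are complete graphs, then all \<open>e\<^sub>r - e\<^sub>i\<close> are present, and reflecting one of them
  in another produces every \<open>e\<^sub>i - e\<^sub>j\<close>.\<close>

lemma ex_balanced_flip: "\<exists>S. balanced (flip S ` \<Phi>)"
proof -
  define joined where
    "joined i j \<longleftrightarrow> i = j \<or> (\<exists>s\<in>{1, -1}. axis i 1 + axis j s \<in> \<Phi>)" for i j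
  have joined_sym: "joined i j \<longleftrightarrow> joined j i" for i j
    unfolding joined_def using pair_commute by blast
  have joined_trans: "joined i k" if ij: "joined i j" and jk: "joined j k" for i j k
  proof (cases "i = j \<or> j = k \<or> i = k")
    case True
    then show ?thesis
      using that by (auto simp: joined_def)
  next
    case False
    have "\<exists>s\<in>{1, -1}. axis i 1 + axis j s \<in> \<Phi>" "\<exists>t\<in>{1, -1}. axis j 1 + axis k t \<in> \<Phi>"
      using ij jk False by (simp_all add: joined_def)
    then obtain s t where st: "s \<in> {1, -1}" "t \<in> {1, -1}"
      and edges: "axis i 1 + axis j s \<in> \<Phi>" "axis j 1 + axis k t \<in> \<Phi>"
      by (elim bexE)
    have "axis i 1 + axis k (- (s * t)) \<in> \<Phi>"
      using pair_compose[OF edges _ _ _ st] False by simp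
    moreover have "- (s * t) \<in> {1, -1}"
      using st by auto
    ultimately show ?thesis
      unfolding joined_def by (intro disjI2 bexI)
  qed
  define r where "r i = (SOME k. joined k i)" for i
  have joined_r: "joined (r i) i" for i
    unfolding r_def by (rule someI[of _ i]) (simp add: joined_def)
  have r_eq: "r i = r j" if "joined i j" for i j
  proof -
    have "joined k i \<longleftrightarrow> joined k j" for k
      using that joined_sym joined_trans by blast
    then show ?thesis by (simp add: r_def)
  qed
  define S where "S = {i. i \<noteq> r i \<and> axis (r i) 1 + axis i (-1) \<notin> \<Phi>}"
  define \<epsilon> :: "'n \<Rightarrow> complex" where "\<epsilon> i = (if i \<in> S then -1 else 1)" for i
  have \<epsilon>: "\<epsilon> i \<in> {1, -1}" for i
    by (simp add: \<epsilon>_def)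
  have base: "axis (r i) 1 + axis i (- \<epsilon> i) \<in> \<Phi>" if "i \<noteq> r i" for i
    using that joined_r[of i] by (auto simp: joined_def S_def \<epsilon>_def)
  have base_sign: "\<epsilon> i = 1" if "i = r i" for i
    using that by (simp add: \<epsilon>_def S_def)
  \<comment> \<open>The sign change multiplies the relative sign of an edge by \<open>\<epsilon> i * \<epsilon> j\<close>.\<close>
  have mem: "axis i 1 + axis j s \<in> flip S ` \<Phi> \<longleftrightarrow> axis i 1 + axis j (\<epsilon> i * \<epsilon> j * s) \<in> \<Phi>"
    if "s \<in> {1, -1}" for i j s
  proof -
    have "flip S (axis i 1 + axis j s) = axis i (\<epsilon> i) + axis j (\<epsilon> j * s)"
      by (simp add: flip_add flip_axis \<epsilon>_def)
    moreover have "\<epsilon> j * s \<in> {1, -1}"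
      using \<epsilon>[of j] that by auto
    ultimately show ?thesis
      using pair_iff[OF \<epsilon>[of i], of "\<epsilon> j * s" i j] by (simp add: mem_flip_image_iff mult.assoc)
  qed
  have "axis i 1 + axis j (-1) \<in> flip S ` \<Phi>"
    if ij: "i \<noteq> j" and plus: "axis i 1 + axis j 1 \<in> flip S ` \<Phi>" for i j
  proof -
    have "\<epsilon> i * \<epsilon> j \<in> {1, -1}"
      using \<epsilon>[of i] \<epsilon>[of j] by auto
    then have "joined i j"
      using plus mem[of 1 i j] by (auto simp: joined_def)
    then have rij: "r i = r j" by (rule r_eq)
    consider "i = r i" | "j = r j" | "i \<noteq> r i" "j \<noteq> r j" by blast
    then have "axis i 1 + axis j (- (\<epsilon> i * \<epsilon> j)) \<in> \<Phi>"
    proof cases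
      case 1
      then show ?thesis using base[of j] base_sign[of i] ij rij by simp
    next
      case 2
      then show ?thesis
        using base[of i] base_sign[of j] ij rij \<epsilon>[of i] pair_commute[of "- \<epsilon> i" j i] by auto
    next
      case 3
      have "- \<epsilon> i \<in> {1, -1}" "- \<epsilon> j \<in> {1, -1}"
        using \<epsilon>[of i] \<epsilon>[of j] by auto
      moreover from this have "axis i 1 + axis (r i) (- \<epsilon> i) \<in> \<Phi>"
        using base[OF 3(1)] pair_commute by blast
      ultimately show ?thesis
        using pair_compose[of i "r i" "- \<epsilon> i" j "- \<epsilon> j"] base[OF 3(2)] 3 ij rij by simp
    qed
    then show ?thesis
      using mem[of "-1" i j] by simp
  qed
  then show ?thesis
    unfolding balanced_def by blast
qed

text \<open>Sign changes permute the two short roots and the two long roots on an index, and preserve the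
  property of carrying edges of both signs, which is why \<open>block_type\<close> asks for both.\<close>

lemma block_type_flip: "block_type (flip S ` \<Phi>) I = block_type \<Phi> I"
proof -
  have single: "axis i c \<in> flip S ` \<Phi> \<longleftrightarrow> axis i c \<in> \<Phi>" for i c
    by (simp add: mem_flip_image_iff flip_axis single_neg)
  have "axis i 1 + axis j 1 \<in> flip S ` \<Phi> \<and> axis i 1 + axis j (-1) \<in> flip S ` \<Phi> \<longleftrightarrow>
      axis i 1 + axis j 1 \<in> \<Phi> \<and> axis i 1 + axis j (-1) \<in> \<Phi>" for i j
    using pair_iff[of "-1" 1 i j] pair_iff[of "-1" "-1" i j]
    by (auto simp: mem_flip_image_iff flip_add flip_axis)
  then show ?thesis
    unfolding block_type_def single by simp
qed

text \<open>In a balanced system \<open>\<Phi>\<close> is determined by its components. Swapping coordinates along the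
  edges \<open>e\<^sub>i - e\<^sub>j\<close> of a component carries any short root, long root or edge \<open>e\<^sub>i + e\<^sub>j\<close> to all other
  places in the component; a short or long root also turns \<open>e\<^sub>i - e\<^sub>j\<close> into \<open>e\<^sub>i + e\<^sub>j\<close>. So each of
  these three kinds of root is either absent from a component or present everywhere in it.\<close>

lemma balanced_direct_sum:
  assumes "balanced \<Phi>"
  shows "\<exists>\<I>. disjoint \<I> \<and> {} \<notin> \<I> \<and> \<Phi> = (\<Union>I\<in>\<I>. classical_roots (block_type \<Phi> I) I)"
proof -
  define R where "R = {(i, j). i = j \<or> axis i 1 + axis j (-1) \<in> \<Phi>}"
  have R_sym: "(j, i) \<in> R" if "(i, j) \<in> R" for i j
    using that pair_commute[of "-1" i j] by (auto simp: R_def)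
  have R_trans: "(i, k) \<in> R" if "(i, j) \<in> R" "(j, k) \<in> R" for i j k
    using that pair_compose[of i j "-1" k "-1"] by (auto simp: R_def)
  have R: "equiv UNIV R"
    by (auto intro!: equivI refl_onI symI transI intro: R_sym R_trans) (simp add: R_def)
  have edge: "axis i 1 + axis j (-1) \<in> \<Phi>" if "(i, j) \<in> R" "i \<noteq> j" for i j
    using that by (simp add: R_def)
  have R_of_pair: "(i, j) \<in> R"
    if "axis i s + axis j t \<in> \<Phi>" "i \<noteq> j" "s \<in> {1, -1}" "t \<in> {1, -1}" for i j s t
    using that pair_iff[of s t i j] assms by (auto simp: R_def balanced_def)
  have single: "axis j c \<in> \<Phi>" if "axis i c \<in> \<Phi>" "(i, j) \<in> R" for i j c
    using that single_transport[of i c j] by (auto simp: R_def)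
  \<comment> \<open>\<open>e\<^sub>i + e\<^sub>j\<close> is carried to \<open>e\<^sub>k + e\<^sub>l\<close> by moving one end at a time; the order of the moves
    matters because the ends must stay distinct.\<close>
  have plus_move: "axis i 1 + axis k 1 \<in> \<Phi>"
    if "axis i 1 + axis j 1 \<in> \<Phi>" "(j, k) \<in> R" "i \<noteq> j" "i \<noteq> k" for i j k
    using that pair_compose[of i j 1 k "-1"] by (auto simp: R_def)
  have plus: "axis k 1 + axis l 1 \<in> \<Phi>"
    if "axis i 1 + axis j 1 \<in> \<Phi>" "i \<noteq> j" "(i, j) \<in> R" "(i, k) \<in> R" "(i, l) \<in> R" "k \<noteq> l" for i j k l
  proof -
    have jk: "(j, k) \<in> R" and jl: "(j, l) \<in> R"
      using that R_sym R_trans by blast+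
    show ?thesis
    proof (cases "l = i")
      case True
      then show ?thesis
        using plus_move[OF that(1) jk] that by (simp add: add.commute)
    next
      case False
      then have "axis l 1 + axis i 1 \<in> \<Phi>"
        using plus_move[OF that(1) jl] that by (simp add: add.commute)
      then show ?thesis
        using plus_move[of l i k] False that by (simp add: add.commute)
    qed
  qed
  have plus_of_single: "axis k 1 + axis l 1 \<in> \<Phi>"
    if "axis i c \<in> \<Phi>" "c \<in> {1, -1, 2, -2}" "(i, k) \<in> R" "(i, l) \<in> R" "k \<noteq> l" for i c k l
    using that plus_of_minus_single[of k c l] single[of i c k] edge[of k l] R_sym R_trans by blast
  have pair: "axis i s + axis j t \<in> \<Phi>"
    if "axis i 1 + axis j 1 \<in> \<Phi>" "i \<noteq> j" "s \<in> {1, -1}" "t \<in> {1, -1}" for i j s t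
    using that pair_iff[of s t i j] edge[OF R_of_pair[OF that(1,2)]] by auto
  define \<I> where "\<I> = UNIV // R"
  have block: "(i, j) \<in> R" if "I \<in> \<I>" "i \<in> I" "j \<in> I" for I i j
    using that R unfolding \<I>_def by (metis quotient_eq_iff)
  have blockI: "\<exists>I\<in>\<I>. i \<in> I \<and> j \<in> I" if "(i, j) \<in> R" for i j
    using that R unfolding \<I>_def by (meson UNIV_I equiv_class_self quotientI Image_singleton_iff)
  have plus_block: "axis k 1 + axis l 1 \<in> \<Phi>"
    if I: "I \<in> \<I>" and not_A: "block_type \<Phi> I \<noteq> Type_A"
      and kl: "k \<in> I" "l \<in> I" "k \<noteq> l" for I k l
  proof -
    consider i c where "i \<in> I" "axis i c \<in> \<Phi>" "c \<in> {1, 2}"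
      | i j where "i \<in> I" "j \<in> I" "i \<noteq> j" "axis i 1 + axis j 1 \<in> \<Phi>"
      using not_A unfolding block_type_def by (auto split: if_splits)
    then show ?thesis
    proof cases
      case 1
      then show ?thesis using plus_of_single[of i c k l] block[OF I] kl by blast
    next
      case 2
      then show ?thesis using plus[of i j k l] block[OF I] kl by blast
    qed
  qed
  have "\<Phi> \<subseteq> (\<Union>I\<in>\<I>. classical_roots (block_type \<Phi> I) I)"
  proof
    fix x assume x: "x \<in> \<Phi>"
    then have "x \<in> roots_BC UNIV"
      using subsystem unfolding root_subsystem_def by blast
    then show "x \<in> (\<Union>I\<in>\<I>. classical_roots (block_type \<Phi> I) I)"
    proof (cases rule: roots_BC_cases)
      case (pair i j s t)
      then have "(i, j) \<in> R" using x R_of_pair by blast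
      then obtain I where I: "I \<in> \<I>" "i \<in> I" "j \<in> I" using blockI by blast
      have D: "x \<in> roots_D I"
        using pair I unfolding roots_D_eq by blast
      \<comment> \<open>Type \<open>A\<close> means that no pair of indices is doubly joined, so balance leaves only \<open>e\<^sub>i - e\<^sub>j\<close>.\<close>
      have "x \<in> roots_A I" if A: "block_type \<Phi> I = Type_A"
      proof -
        have "axis i 1 + axis j 1 \<notin> \<Phi>"
          using A I \<open>i \<noteq> j\<close> edge[OF \<open>(i, j) \<in> R\<close>] unfolding block_type_def
          by (auto split: if_splits)
        then have "s * t \<noteq> 1"
          using x pair pair_iff[of s t i j] by auto
        then have "s = 1 \<and> t = -1 \<or> s = -1 \<and> t = 1"
          using pair by auto
        then have "x = axis i 1 + axis j (-1) \<or> x = axis j 1 + axis i (-1)"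
          using pair by (auto simp: add.commute)
        then show ?thesis
          using I \<open>i \<noteq> j\<close> unfolding roots_A_eq by blast
      qed
      with D have "x \<in> classical_roots (block_type \<Phi> I) I"
        by (cases "block_type \<Phi> I") (auto simp: roots_BC_def roots_B_eq roots_C_eq)
      then show ?thesis using I by blast
    next
      case (single i c)
      obtain I where I: "I \<in> \<I>" "i \<in> I"
        using blockI[of i i] by (auto simp: R_def)
      have "x \<in> classical_roots (block_type \<Phi> I) I"
      proof (cases "c \<in> {1, -1}")
        case True
        then have "block_type \<Phi> I \<in> {Type_B, Type_BC}"
          using x single I by (auto simp: block_type_def single_neg)
        moreover have "x \<in> roots_B I"
          using single True I unfolding roots_B_eq by blast
        ultimately show ?thesis by (auto simp: roots_BC_def)
      next
        case False
        then have c: "c \<in> {2, -2}" using single by blast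
        then have "block_type \<Phi> I \<in> {Type_C, Type_BC}"
          using x single I by (auto simp: block_type_def single_neg)
        moreover have "x \<in> roots_C I"
          using single c I unfolding roots_C_eq by blast
        ultimately show ?thesis by (auto simp: roots_BC_def)
      qed
      then show ?thesis using I by blast
    qed
  qed
  moreover have "classical_roots (block_type \<Phi> I) I \<subseteq> \<Phi>" if I: "I \<in> \<I>" for I
  proof -
    have A: "roots_A I \<subseteq> \<Phi>"
      using edge block[OF I] unfolding roots_A_eq by blast
    have D: "roots_D I \<subseteq> \<Phi>" if "block_type \<Phi> I \<noteq> Type_A"
      using pair plus_block[OF I that] unfolding roots_D_eq by blast
    have short: "axis i s \<in> \<Phi>"
      if marked: "block_type \<Phi> I \<in> {Type_B, Type_BC}" and i: "i \<in> I" and s: "s \<in> {1, -1}" for i s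
    proof -
      obtain j where "j \<in> I" "axis j 1 \<in> \<Phi>"
        using marked by (auto simp: block_type_def split: if_splits)
      then have "axis i 1 \<in> \<Phi>"
        using single block[OF I] i by blast
      then show ?thesis using s by (auto simp: single_neg)
    qed
    have long: "axis i s \<in> \<Phi>"
      if marked: "block_type \<Phi> I \<in> {Type_C, Type_BC}" and i: "i \<in> I" and s: "s \<in> {2, -2}" for i s
    proof -
      obtain j where "j \<in> I" "axis j 2 \<in> \<Phi>"
        using marked by (auto simp: block_type_def split: if_splits)
      then have "axis i 2 \<in> \<Phi>"
        using single block[OF I] i by blast
      then show ?thesis using s by (auto simp: single_neg)
    qed
    show ?thesis
    proof (cases "block_type \<Phi> I")
      case Type_A
      then show ?thesis using A by simp
    next
      case Type_D
      then show ?thesis using D by simp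
    next
      case Type_B
      then show ?thesis using D short by (auto simp: roots_B_eq)
    next
      case Type_C
      then show ?thesis using D long by (auto simp: roots_C_eq)
    next
      case Type_BC
      then show ?thesis using D short long by (auto simp: roots_BC_def roots_B_eq roots_C_eq)
    qed
  qed
  ultimately have "\<Phi> = (\<Union>I\<in>\<I>. classical_roots (block_type \<Phi> I) I)"
    by blast
  moreover have "disjoint \<I>" "{} \<notin> \<I>"
    using R quotient_disj[OF R] in_quotient_imp_non_empty[OF R]
    unfolding \<I>_def pairwise_def disjnt_def by blast+
  ultimately show ?thesis by blast
qed

end

section \<open>Classification of the root subsystems\<close>

lemma equivalent_direct_sum:
  assumes "root_subsystem (roots_BC UNIV) \<Phi>" and types: "range (block_type \<Phi>) \<subseteq> T"
  shows "\<exists>\<Psi>. direct_sum_of_types T \<Psi> \<and> equivalent_subsystems \<Phi> \<Psi>"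
proof -
  obtain S where S: "balanced (flip S ` \<Phi>)"
    using ex_balanced_flip[OF assms(1)] by blast
  have sub: "root_subsystem (roots_BC UNIV) (flip S ` \<Phi>)"
    using root_subsystem_flip[OF assms(1)] .
  have "block_type (flip S ` \<Phi>) ` \<I> \<subseteq> T" for \<I>
    using types block_type_flip[OF assms(1)] by auto
  then have "direct_sum_of_types T (flip S ` \<Phi>)"
    using balanced_direct_sum[OF sub S] unfolding direct_sum_of_types_def by blast
  moreover have "equivalent_subsystems \<Phi> (flip S ` \<Phi>)"
    using assms(1) sub flip_in_weyl_group unfolding equivalent_subsystems_def by blast
  ultimately show ?thesis by blast
qed

theorem corollary4p3p1:
  fixes \<Phi> \<Phi>' :: "(complex ^ 'n::finite) set"
  assumes "root_subsystem (roots_BC UNIV) \<Phi>"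
    and "root_subsystem (roots_BC UNIV) \<Phi>'"
    and "\<Phi>' \<subseteq> \<Phi>"
  shows "(\<Phi> = roots_A UNIV \<longrightarrow>
            (\<exists>\<Psi>. direct_sum_of_types {Type_A} \<Psi> \<and> equivalent_subsystems \<Phi>' \<Psi>))
       \<and> (\<Phi> = roots_D UNIV \<longrightarrow>
            (\<exists>\<Psi>. direct_sum_of_types {Type_A, Type_D} \<Psi> \<and> equivalent_subsystems \<Phi>' \<Psi>))
       \<and> (\<Phi> = roots_B UNIV \<longrightarrow>
            (\<exists>\<Psi>. direct_sum_of_types {Type_A, Type_D, Type_B} \<Psi> \<and> equivalent_subsystems \<Phi>' \<Psi>))
       \<and> (\<Phi> = roots_C UNIV \<longrightarrow>
            (\<exists>\<Psi>. direct_sum_of_types {Type_A, Type_D, Type_C} \<Psi> \<and> equivalent_subsystems \<Phi>' \<Psi>))"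
proof (intro conjI impI)
  assume "\<Phi> = roots_A UNIV"
  then have A: "\<Phi>' \<subseteq> roots_A UNIV" using assms(3) by simp
  moreover have "roots_A UNIV \<subseteq> (roots_D UNIV :: (complex ^ 'n) set)"
    unfolding roots_D_def by blast
  ultimately have "block_type \<Phi>' I = Type_A" for I
    unfolding block_type_def using axis_notin_roots_D plus_notin_roots_A by (auto; blast)
  then show "\<exists>\<Psi>. direct_sum_of_types {Type_A} \<Psi> \<and> equivalent_subsystems \<Phi>' \<Psi>"
    by (intro equivalent_direct_sum assms) auto
next
  assume "\<Phi> = roots_D UNIV"
  then have "axis i c \<notin> \<Phi>'" for i c
    using assms(3) axis_notin_roots_D by blast
  then have "block_type \<Phi>' I \<in> {Type_A, Type_D}" for I
    unfolding block_type_def by simp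
  then show "\<exists>\<Psi>. direct_sum_of_types {Type_A, Type_D} \<Psi> \<and> equivalent_subsystems \<Phi>' \<Psi>"
    by (intro equivalent_direct_sum assms) blast
next
  assume "\<Phi> = roots_B UNIV"
  then have "axis i 2 \<notin> \<Phi>'" for i
    using assms(3) long_notin_roots_B by blast
  then have "block_type \<Phi>' I \<in> {Type_A, Type_D, Type_B}" for I
    unfolding block_type_def by simp
  then show "\<exists>\<Psi>. direct_sum_of_types {Type_A, Type_D, Type_B} \<Psi> \<and> equivalent_subsystems \<Phi>' \<Psi>"
    by (intro equivalent_direct_sum assms) blast
next
  assume "\<Phi> = roots_C UNIV"
  then have "axis i 1 \<notin> \<Phi>'" for i
    using assms(3) short_notin_roots_C by blast
  then have "block_type \<Phi>' I \<in> {Type_A, Type_D, Type_C}" for I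
    unfolding block_type_def by simp
  then show "\<exists>\<Psi>. direct_sum_of_types {Type_A, Type_D, Type_C} \<Psi> \<and> equivalent_subsystems \<Phi>' \<Psi>"
    by (intro equivalent_direct_sum assms) blast
qed

end
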